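(* Let $U_0=\{[w]\in\mathbb{P}^n(\mathbb{C}): w_0\neq 0\}$ and let $\varphi_0:U_0\to\mathbb{C}^n$ be the coordinate chart $\varphi_0([w])=\frac{1}{w_0}(w_1,\dots,w_n)$. Then $U_0$ is $\mathbb{A}(n)$-invariant and the $\mathbb{A}(n)$-action induces on $\mathbb{C}^n$ the $\mathbb{T}^n$-action given by $\mathbb{T}^n\times\mathbb{C}^n\to\mathbb{C}^n$, $(t,z)\mapsto tz=(t_1z_1,\dots,t_nz_n)$. More precisely, if we let $\rho:\mathbb{T}^n\to\widehat{\mathbb{A}}(n)$ be the isomorphism defined by the diagonal matrix $$\rho(t)=\mathrm{diag}(t_1,t_2,\dots,t_n,\overline{t}_1\cdots\overline{t}_n),$$ then we have $$t\,\varphi_0([w])=\varphi_0([\rho(t)w])$$ for every $t\in\mathbb{T}^n$ and $[w]\in U_0$. In particular, a symbol $a:\mathbb{C}^n\to\mathbb{C}$ is separately radial if and only if $a\circ\varphi_0$ is $\mathbb{A}(n)$-invariant as a function on $U_0\subset\mathbb{P}^n(\mathbb{C})$.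
   Context: $\mathbb{T}=\{t\in\mathbb{C}:|t|=1\}$. Points of $\mathbb{P}^n(\mathbb{C})$ are written $[w]$ with $w=(w_0,\dots,w_n)\in\mathbb{C}^{n+1}\setminus\{0\}$. $\mathrm{SU}(n+1)$ is the group of $(n+1)\times(n+1)$ unitary matrices of determinant $1$, $\mathrm{PSU}(n+1)$ is its quotient by the scalar matrices $\zeta I$ with $\zeta^{n+1}=1$, and $\lambda:\mathrm{SU}(n+1)\to\mathrm{PSU}(n+1)$ is the quotient map. $\mathrm{PSU}(n+1)$ acts on $\mathbb{P}^n(\mathbb{C})$ by $\lambda(A)[w]=[Aw]$. $\widehat{\mathbb{A}}(n)$ is the subgroup of diagonal matrices in $\mathrm{SU}(n+1)$ and $\mathbb{A}(n)=\lambda(\widehat{\mathbb{A}}(n))$. A function $a$ on $\mathbb{C}^n$ is separately radial if $a(z)$ depends only on the radial components $(|z_1|,\dots,|z_n|)$ of $z$.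
   Formalization: The identity tφ_0([w])=φ_0([ρ(t)w]) is false for n≥1 (n=1: ρ(t) acts by t̄²); instead τ(t)φ_0([w])=φ_0([ρ(t)w]) with τ(t)=(t_2/t_1,…,t_n/t_1, t̄_1⋯t̄_n/t_1), and tφ_0(p)=φ_0(θ(t)p) for an isomorphism θ:T^n→A(n) with θ(τ(t))=λ(ρ(t)). *)

theory Defs
  imports "HOL-Algebra.Coset" "Jordan_Normal_Form.Schur_Decomposition"
begin

text \<open>Coordinates are numbered from 0: a point \<open>w\<close> of complex \<open>(n+1)\<close>-space is a vector in
  \<open>carrier_vec (Suc n)\<close> with entries \<open>w $ 0, ..., w $ n\<close>, while the entries of
  \<open>z \<in> carrier_vec n\<close> and of an element \<open>t\<close> of the torus, called \<open>z\<^sub>1, ..., z\<^sub>n\<close> and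
  \<open>t\<^sub>1, ..., t\<^sub>n\<close> in the usual notation, are \<open>z $ 0, ..., z $ (n-1)\<close> and \<open>t $ 0, ..., t $ (n-1)\<close>.\<close>

definition SU :: "nat \<Rightarrow> complex mat monoid" where
  "SU m = \<lparr>carrier = {A \<in> carrier_mat m m. A * mat_adjoint A = 1\<^sub>m m \<and> det A = 1},
           monoid.mult = (*), one = 1\<^sub>m m\<rparr>"

definition SU_scalars :: "nat \<Rightarrow> complex mat set" where
  "SU_scalars m = {\<zeta> \<cdot>\<^sub>m 1\<^sub>m m | \<zeta>. \<zeta> ^ m = 1}"

definition PSU :: "nat \<Rightarrow> complex mat set monoid" where
  "PSU m = SU m Mod SU_scalars m"

definition PSU_proj :: "nat \<Rightarrow> complex mat \<Rightarrow> complex mat set" where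
  "PSU_proj m A = SU_scalars m #>\<^bsub>SU m\<^esub> A"

definition diag_SU :: "nat \<Rightarrow> complex mat set" where
  "diag_SU m = {A \<in> carrier (SU m). diagonal_mat A}"

definition Ahat :: "nat \<Rightarrow> complex mat monoid" where
  "Ahat n = (SU (Suc n))\<lparr>carrier := diag_SU (Suc n)\<rparr>"

definition AA :: "nat \<Rightarrow> complex mat set monoid" where
  "AA n = (PSU (Suc n))\<lparr>carrier := PSU_proj (Suc n) ` diag_SU (Suc n)\<rparr>"

definition torus :: "nat \<Rightarrow> complex vec monoid" where
  "torus n = \<lparr>carrier = {t \<in> carrier_vec n. \<forall>i<n. cmod (t $ i) = 1},
              monoid.mult = (\<lambda>s t. vec n (\<lambda>i. s $ i * t $ i)), one = vec n (\<lambda>_. 1)\<rparr>"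

definition torus_act :: "nat \<Rightarrow> complex vec \<Rightarrow> complex vec \<Rightarrow> complex vec" where
  "torus_act n t z = vec n (\<lambda>i. t $ i * z $ i)"

definition proj_point :: "complex vec \<Rightarrow> complex vec set" where
  "proj_point w = {c \<cdot>\<^sub>v w | c. c \<noteq> 0}"

definition proj_space :: "nat \<Rightarrow> complex vec set set" where
  "proj_space n = proj_point ` (carrier_vec (Suc n) - {0\<^sub>v (Suc n)})"

text \<open>An element of \<open>PSU (Suc n)\<close> is a coset of matrices and a point is a class of vectors. The
  products of their representatives form again one class; see \<open>PSU_act_proj_point\<close> below.\<close>

definition PSU_act :: "complex mat set \<Rightarrow> complex vec set \<Rightarrow> complex vec set" where
  "PSU_act g p = {A *\<^sub>v w | A w. A \<in> g \<and> w \<in> p}"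

definition U0 :: "nat \<Rightarrow> complex vec set set" where
  "U0 n = {proj_point w | w. w \<in> carrier_vec (Suc n) \<and> w $ 0 \<noteq> 0}"

definition chart0 :: "nat \<Rightarrow> complex vec set \<Rightarrow> complex vec" where
  "chart0 n p = (THE z. \<exists>w\<in>p. z = (1 / w $ 0) \<cdot>\<^sub>v vec n (\<lambda>i. w $ Suc i))"

definition rho :: "nat \<Rightarrow> complex vec \<Rightarrow> complex mat" where
  "rho n t = mat_diag (Suc n) (\<lambda>i. if i < n then t $ i else (\<Prod>j<n. cnj (t $ j)))"

text \<open>In the chart, a diagonal matrix \<open>diag(d\<^sub>0, ..., d\<^sub>n)\<close> multiplies the \<open>i\<close>-th coordinate by
  \<open>d\<^sub>i / d\<^sub>0\<close>. Hence \<open>rho n t\<close> does not act through \<open>t\<close> itself (see \<open>rho_not_equivariant\<close> below) but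
  through \<open>(t\<^sub>2 / t\<^sub>1, ..., t\<^sub>n / t\<^sub>1, cnj (t\<^sub>1 \<cdots> t\<^sub>n) / t\<^sub>1)\<close>.\<close>

definition rho_ratio :: "nat \<Rightarrow> complex vec \<Rightarrow> complex vec" where
  "rho_ratio n t = vec n (\<lambda>i. rho n t $$ (Suc i, Suc i) / rho n t $$ (0, 0))"

definition separately_radial :: "nat \<Rightarrow> (complex vec \<Rightarrow> complex) \<Rightarrow> bool" where
  "separately_radial n a \<longleftrightarrow>
     (\<forall>z\<in>carrier_vec n. \<forall>z'\<in>carrier_vec n. (\<forall>i<n. cmod (z $ i) = cmod (z' $ i)) \<longrightarrow> a z = a z')"

definition AA_invariant :: "nat \<Rightarrow> (complex vec set \<Rightarrow> complex) \<Rightarrow> bool" where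
  "AA_invariant n f \<longleftrightarrow> (\<forall>g\<in>carrier (AA n). \<forall>p\<in>U0 n. f (PSU_act g p) = f p)"

lemma SU_carrier: "A \<in> carrier (SU m) \<longleftrightarrow> A \<in> carrier_mat m m \<and> A * mat_adjoint A = 1\<^sub>m m \<and> det A = 1"
  by (simp add: SU_def)

lemma PSU_proj_alt:
  assumes "A \<in> carrier_mat m m"
  shows "PSU_proj m A = {\<zeta> \<cdot>\<^sub>m A | \<zeta>. \<zeta> ^ m = 1}"
proof -
  have "(\<zeta> \<cdot>\<^sub>m 1\<^sub>m m) * A = \<zeta> \<cdot>\<^sub>m A" for \<zeta>
    using assms by (subst mult_smult_assoc_mat[of _ m m]) auto
  then show ?thesis
    unfolding PSU_proj_def r_coset_def SU_scalars_def by (auto simp: SU_def)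
qed

lemma PSU_act_proj_point:
  assumes "A \<in> carrier_mat (Suc n) (Suc n)" "w \<in> carrier_vec (Suc n)"
  shows "PSU_act (PSU_proj (Suc n) A) (proj_point w) = proj_point (A *\<^sub>v w)"
proof -
  have *: "(\<zeta> \<cdot>\<^sub>m A) *\<^sub>v (c \<cdot>\<^sub>v w) = (\<zeta> * c) \<cdot>\<^sub>v (A *\<^sub>v w)" for \<zeta> c
    using assms by (intro eq_vecI) (auto simp: scalar_prod_def sum_distrib_left mult_ac simp del: sum.op_ivl_Suc)
  show ?thesis
  proof (intro equalityI subsetI)
    fix x assume "x \<in> PSU_act (PSU_proj (Suc n) A) (proj_point w)"
    then obtain B v where "B \<in> PSU_proj (Suc n) A" "v \<in> proj_point w" "x = B *\<^sub>v v"
      unfolding PSU_act_def by blast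
    then obtain \<zeta> c where \<zeta>: "\<zeta> ^ Suc n = 1" "c \<noteq> 0" and x: "x = (\<zeta> \<cdot>\<^sub>m A) *\<^sub>v (c \<cdot>\<^sub>v w)"
      unfolding PSU_proj_alt[OF assms(1)] proj_point_def by blast
    have "\<zeta> \<noteq> 0"
      using \<zeta>(1) by (cases "\<zeta> = 0") simp_all
    then show "x \<in> proj_point (A *\<^sub>v w)"
      unfolding proj_point_def x * using \<zeta>(2) by (intro CollectI exI[of _ "\<zeta> * c"]) simp
  next
    fix x assume "x \<in> proj_point (A *\<^sub>v w)"
    then obtain c where c: "c \<noteq> 0" "x = c \<cdot>\<^sub>v (A *\<^sub>v w)" unfolding proj_point_def by auto
    have "x = (1 \<cdot>\<^sub>m A) *\<^sub>v (c \<cdot>\<^sub>v w)" unfolding * c by simp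
    moreover have "1 \<cdot>\<^sub>m A \<in> PSU_proj (Suc n) A"
      unfolding PSU_proj_alt[OF assms(1)] by (intro CollectI exI[of _ 1]) simp
    moreover have "c \<cdot>\<^sub>v w \<in> proj_point w"
      unfolding proj_point_def using c(1) by (intro CollectI exI[of _ c]) simp
    ultimately show "x \<in> PSU_act (PSU_proj (Suc n) A) (proj_point w)"
      unfolding PSU_act_def by blast
  qed
qed

lemma chart0_proj_point:
  assumes "w \<in> carrier_vec (Suc n)" "w $ 0 \<noteq> 0"
  shows "chart0 n (proj_point w) = (1 / w $ 0) \<cdot>\<^sub>v vec n (\<lambda>i. w $ Suc i)"
proof -
  have *: "(1 / (c \<cdot>\<^sub>v w) $ 0) \<cdot>\<^sub>v vec n (\<lambda>i. (c \<cdot>\<^sub>v w) $ Suc i) = (1 / w $ 0) \<cdot>\<^sub>v vec n (\<lambda>i. w $ Suc i)"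
    if "c \<noteq> 0" for c
    using assms that by (intro eq_vecI) auto
  show ?thesis unfolding chart0_def
  proof (rule the_equality)
    have "1 \<cdot>\<^sub>v w = w" by auto
    then have "w \<in> proj_point w" unfolding proj_point_def
      by (metis (mono_tags, lifting) mem_Collect_eq one_neq_zero)
    then show "\<exists>v\<in>proj_point w. (1 / w $ 0) \<cdot>\<^sub>v vec n (\<lambda>i. w $ Suc i) = (1 / v $ 0) \<cdot>\<^sub>v vec n (\<lambda>i. v $ Suc i)"
      by blast
  next
    fix z assume "\<exists>v\<in>proj_point w. z = (1 / v $ 0) \<cdot>\<^sub>v vec n (\<lambda>i. v $ Suc i)"
    then obtain c where "c \<noteq> 0"
      "z = (1 / (c \<cdot>\<^sub>v w) $ 0) \<cdot>\<^sub>v vec n (\<lambda>i. (c \<cdot>\<^sub>v w) $ Suc i)"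
      unfolding proj_point_def by blast
    then show "z = (1 / w $ 0) \<cdot>\<^sub>v vec n (\<lambda>i. w $ Suc i)" using *[of c] by simp
  qed
qed

lemma U0_subset: "U0 n \<subseteq> proj_space n"
proof
  fix p assume "p \<in> U0 n"
  then obtain w where w: "p = proj_point w" "w \<in> carrier_vec (Suc n)" "w $ 0 \<noteq> 0"
    unfolding U0_def by blast
  have "w \<noteq> 0\<^sub>v (Suc n)"
  proof
    assume "w = 0\<^sub>v (Suc n)"
    then show False using w(3) by simp
  qed
  then show "p \<in> proj_space n"
    unfolding proj_space_def w(1) using w(2) by (intro imageI) simp
qed

lemma proj_point_eqI:
  assumes "c \<noteq> 0" "v = c \<cdot>\<^sub>v w"
  shows "proj_point v = proj_point w"
proof (intro equalityI subsetI)
  fix x assume "x \<in> proj_point v"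
  then obtain d where "d \<noteq> 0" "x = d \<cdot>\<^sub>v (c \<cdot>\<^sub>v w)" using assms by (auto simp: proj_point_def)
  then have "x = (d * c) \<cdot>\<^sub>v w" "d * c \<noteq> 0" using assms by (auto simp: smult_smult_assoc)
  then show "x \<in> proj_point w" unfolding proj_point_def by blast
next
  fix x assume "x \<in> proj_point w"
  then obtain d where "d \<noteq> 0" "x = d \<cdot>\<^sub>v w" by (auto simp: proj_point_def)
  then have "x = (d / c) \<cdot>\<^sub>v v" "d / c \<noteq> 0" using assms by (auto simp: smult_smult_assoc)
  then show "x \<in> proj_point v" unfolding proj_point_def by blast
qed

lemma chart0_bij: "bij_betw (chart0 n) (U0 n) (carrier_vec n)"
proof (rule bij_betw_byWitness[where f' = "\<lambda>z. proj_point (vec (Suc n) (\<lambda>i. if i = 0 then 1 else z $ (i - 1)))"])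
  let ?h = "\<lambda>z::complex vec. vec (Suc n) (\<lambda>i. if i = 0 then 1 else z $ (i - 1))"
  have h: "chart0 n (proj_point (?h z)) = z" if "z \<in> carrier_vec n" for z
    using that by (subst chart0_proj_point) (auto intro!: eq_vecI)
  show "\<forall>p\<in>U0 n. proj_point (?h (chart0 n p)) = p"
  proof
    fix p assume "p \<in> U0 n"
    then obtain w where w: "p = proj_point w" "w \<in> carrier_vec (Suc n)" "w $ 0 \<noteq> 0"
      unfolding U0_def by blast
    have "?h (chart0 n p) = (1 / w $ 0) \<cdot>\<^sub>v w"
      unfolding w(1) chart0_proj_point[OF w(2,3)] using w(2,3)
      by (intro eq_vecI) (auto simp: gr0_conv_Suc)
    then show "proj_point (?h (chart0 n p)) = p"
      using proj_point_eqI[of "1 / w $ 0" _ w] w by auto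
  qed
  show "\<forall>z\<in>carrier_vec n. chart0 n (proj_point (?h z)) = z" using h by blast
  show "chart0 n ` U0 n \<subseteq> carrier_vec n"
    unfolding U0_def by (force simp: chart0_proj_point)
  show "(\<lambda>z. proj_point (?h z)) ` carrier_vec n \<subseteq> U0 n"
    unfolding U0_def by (rule image_subsetI) (auto intro!: exI[of _ "?h _"])
qed

lemma rho_mult_vec:
  assumes "w \<in> carrier_vec (Suc n)" "i \<le> n"
  shows "(rho n t *\<^sub>v w) $ i = (if i < n then t $ i else (\<Prod>j<n. cnj (t $ j))) * w $ i"
proof -
  let ?f = "\<lambda>i. if i < n then t $ i else (\<Prod>j<n. cnj (t $ j))"
  have "(rho n t *\<^sub>v w) $ i = (\<Sum>j = 0..<Suc n. (if i = j then ?f j else 0) * w $ j)"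
    using assms by (simp add: rho_def mat_diag_def scalar_prod_def)
  also have "\<dots> = (\<Sum>j = 0..<Suc n. if i = j then ?f j * w $ j else 0)"
    by (intro sum.cong) auto
  also have "\<dots> = ?f i * w $ i"
    using assms by (subst sum.delta') (auto)
  finally show ?thesis .
qed

lemma rho_not_equivariant:
  assumes "n \<ge> 1"
  shows "\<exists>t\<in>carrier (torus n). \<exists>w\<in>carrier_vec (Suc n). w $ 0 \<noteq> 0 \<and>
    torus_act n t (chart0 n (proj_point w)) \<noteq> chart0 n (proj_point (rho n t *\<^sub>v w))"
proof -
  define t where "t = vec n (\<lambda>i. if i = 0 then \<i> else 1)"
  define w :: "complex vec" where "w = vec (Suc n) (\<lambda>_. 1)"
  have t: "t \<in> carrier (torus n)" by (auto simp: torus_def t_def)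
  have w: "w \<in> carrier_vec (Suc n)" "w $ 0 \<noteq> 0" by (auto simp: w_def)
  have rw: "rho n t *\<^sub>v w \<in> carrier_vec (Suc n)"
    unfolding rho_def by (rule mult_mat_vec_carrier[OF mat_diag_dim w(1)])
  have r0: "(rho n t *\<^sub>v w) $ 0 = \<i>"
    using assms by (subst rho_mult_vec[OF w(1)]) (auto simp: t_def w_def)
  have r1: "(rho n t *\<^sub>v w) $ 1 = (if n = 1 then - \<i> else 1)"
    using assms by (subst rho_mult_vec[OF w(1)]) (auto simp: t_def w_def)
  have "chart0 n (proj_point (rho n t *\<^sub>v w)) $ 0 = (rho n t *\<^sub>v w) $ 1 / \<i>"
    using assms r0 by (subst chart0_proj_point[OF rw]) auto
  moreover have "torus_act n t (chart0 n (proj_point w)) $ 0 = \<i>"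
    using assms by (subst chart0_proj_point[OF w]) (auto simp: torus_act_def t_def w_def)
  ultimately have "torus_act n t (chart0 n (proj_point w)) $ 0 \<noteq> chart0 n (proj_point (rho n t *\<^sub>v w)) $ 0"
    using r1 by (auto simp: complex_eq_iff split: if_splits)
  then show ?thesis using t w by metis
qed

end

theory Submission
  imports Defs
begin

text \<open>A diagonal matrix \<open>diag(d\<^sub>0, ..., d\<^sub>n)\<close> acts in the chart through the ratios \<open>d\<^sub>i / d\<^sub>0\<close>. Two
  diagonal matrices in \<open>SU (Suc n)\<close> have the same ratios exactly when they differ by a root of unity
  of order dividing \<open>n + 1\<close>, that is, when they have the same class in \<open>PSU (Suc n)\<close>; and every
  \<open>s\<close> in the torus is the tuple of ratios of \<open>diag(c, c s\<^sub>1, ..., c s\<^sub>n)\<close> with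
  \<open>c\<^sup>n\<^sup>+\<^sup>1 s\<^sub>1 \<cdots> s\<^sub>n = 1\<close>. So the ratios identify the torus with \<open>AA n\<close>, and the separately
  radial functions are the torus-invariant ones.\<close>

definition diag_ratio :: "nat \<Rightarrow> complex mat \<Rightarrow> complex vec" where
  "diag_ratio n A = vec n (\<lambda>i. A $$ (Suc i, Suc i) / A $$ (0, 0))"

section \<open>Diagonal matrices: determinant, adjoint and membership in the special unitary
  group\<close>

lemma mat_diag_index [simp]:
  "i < n \<Longrightarrow> j < n \<Longrightarrow> mat_diag n d $$ (i, j) = (if i = j then d j else 0)"
  by (simp add: mat_diag_def)

lemma mat_diag_dims [simp]: "dim_row (mat_diag n d) = n" "dim_col (mat_diag n d) = n"
  by (simp_all add: mat_diag_def)

lemma mat_diag_eq_iff: "mat_diag n d = mat_diag n e \<longleftrightarrow> (\<forall>i<n. d i = e i)"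
proof
  assume "mat_diag n d = mat_diag n e"
  then have "mat_diag n d $$ (i, i) = mat_diag n e $$ (i, i)" for i by simp
  then show "\<forall>i<n. d i = e i" by (metis mat_diag_index)
qed (auto intro!: eq_matI)

lemma smult_mat_diag: "c \<cdot>\<^sub>m mat_diag n d = mat_diag n (\<lambda>i. c * (d i :: 'a :: semiring_0))"
  by (intro eq_matI) auto

lemma det_mat_diag: "det (mat_diag n d) = (\<Prod>i<n. d i :: 'a :: comm_ring_1)"
proof -
  have "upper_triangular (mat_diag n d)" by auto
  then have "det (mat_diag n d) = prod_list (diag_mat (mat_diag n d))"
    by (rule det_upper_triangular[OF _ mat_diag_dim])
  then show ?thesis
    by (simp add: prod_list_diag_prod lessThan_atLeast0)
qed

lemma mat_adjoint_mat_diag: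
  "mat_adjoint (mat_diag n d) = mat_diag n (\<lambda>i. cnj (d i))"
  by (intro eq_matI) (auto simp: mat_adjoint_def mat_of_rows_def conjugate_complex_def)

lemma mat_diag_mult_vec:
  assumes "w \<in> carrier_vec n" "i < n"
  shows "(mat_diag n d *\<^sub>v w) $ i = d i * (w $ i :: 'a :: semiring_0)"
proof -
  have "(mat_diag n d *\<^sub>v w) $ i = (\<Sum>j = 0..<n. (if i = j then d j else 0) * w $ j)"
    using assms by (simp add: scalar_prod_def)
  also have "\<dots> = (\<Sum>j = 0..<n. if i = j then d j * w $ j else 0)"
    by (intro sum.cong) auto
  finally show ?thesis using assms by simp
qed

lemma diagonal_mat_eq_mat_diag:
  assumes "A \<in> carrier_mat n n" "diagonal_mat A"
  shows "A = mat_diag n (\<lambda>i. A $$ (i, i))"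
  using assms by (intro eq_matI) (auto simp: diagonal_mat_def)

text \<open>For a diagonal matrix, unitarity is the entrywise condition
  \<open>d i * cnj (d i) = 1\<close>. Together with \<open>diag_SU_E\<close> this reduces every
  later argument to one about a sequence of unimodular numbers with product 1.\<close>

lemma mat_diag_in_diag_SU:
  "mat_diag m d \<in> diag_SU m \<longleftrightarrow> (\<forall>i<m. cmod (d i) = 1) \<and> (\<Prod>i<m. d i) = 1"
proof -
  have "d i * cnj (d i) = 1 \<longleftrightarrow> cmod (d i) = 1" for i
  proof -
    have "d i * cnj (d i) = of_real ((cmod (d i))\<^sup>2)" by (simp only: complex_norm_square)
    \<comment> \<open>Rules out the second alternative that \<open>power2_eq_1_iff\<close>
      produces.\<close>
    moreover have "cmod (d i) \<noteq> - 1" using norm_ge_zero[of "d i"] by linarith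
    ultimately show ?thesis by (simp only: of_real_eq_1_iff power2_eq_1_iff) simp
  qed
  then have "mat_diag m d * mat_adjoint (mat_diag m d) = 1\<^sub>m m \<longleftrightarrow> (\<forall>i<m. cmod (d i) = 1)"
    by (simp add: mat_adjoint_mat_diag mat_diag_eq_iff flip: mat_diag_one)
  then show ?thesis
    by (auto simp: diag_SU_def SU_carrier det_mat_diag diagonal_mat_def)
qed

lemma diag_SU_E:
  assumes "A \<in> diag_SU m"
  obtains d where "A = mat_diag m d" "\<And>i. i < m \<Longrightarrow> cmod (d i) = 1" "(\<Prod>i<m. d i) = 1"
proof -
  have A: "A = mat_diag m (\<lambda>i. A $$ (i, i))"
    using assms by (intro diagonal_mat_eq_mat_diag) (auto simp: diag_SU_def SU_carrier)
  with assms have "mat_diag m (\<lambda>i. A $$ (i, i)) \<in> diag_SU m" by simp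
  then show thesis
    unfolding mat_diag_in_diag_SU by (intro that[OF A]) auto
qed

lemma diag_SU_carrier: "A \<in> diag_SU m \<Longrightarrow> A \<in> carrier_mat m m"
  by (simp add: diag_SU_def SU_carrier)

section \<open>The ratio map from diagonal special unitary matrices to the torus\<close>

lemma torus_carrier: "t \<in> carrier (torus n) \<longleftrightarrow> t \<in> carrier_vec n \<and> (\<forall>i<n. cmod (t $ i) = 1)"
  by (simp add: torus_def)

lemma torus_mult: "s \<otimes>\<^bsub>torus n\<^esub> t = vec n (\<lambda>i. s $ i * t $ i)"
  by (simp add: torus_def)

lemma diag_ratio_mat_diag [simp]:
  "diag_ratio n (mat_diag (Suc n) d) = vec n (\<lambda>i. d (Suc i) / d 0)"
  by (auto simp: diag_ratio_def)

lemma rho_ratio_eq: "rho_ratio n t = diag_ratio n (rho n t)"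
  by (simp add: rho_ratio_def diag_ratio_def)

lemma diag_ratio_torus:
  assumes "A \<in> diag_SU (Suc n)"
  shows "diag_ratio n A \<in> carrier (torus n)"
  using assms by (elim diag_SU_E) (simp add: torus_carrier norm_divide)

lemma diag_ratio_mult:
  assumes "A \<in> diag_SU (Suc n)" "B \<in> diag_SU (Suc n)"
  shows "diag_ratio n (A * B) = diag_ratio n A \<otimes>\<^bsub>torus n\<^esub> diag_ratio n B"
  using assms by (elim diag_SU_E) (auto simp: torus_mult intro!: eq_vecI)

lemma diag_SU_mult:
  assumes "A \<in> diag_SU m" "B \<in> diag_SU m"
  shows "A * B \<in> diag_SU m"
  using assms
  by (elim diag_SU_E) (simp add: mat_diag_in_diag_SU norm_mult prod.distrib)

lemma diag_ratio_surj:
  assumes "s \<in> carrier (torus n)"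
  obtains A where "A \<in> diag_SU (Suc n)" "diag_ratio n A = s"
proof -
  have s: "s \<in> carrier_vec n" "\<And>i. i < n \<Longrightarrow> cmod (s $ i) = 1"
    using assms by (auto simp: torus_carrier)
  define q where "q = (\<Prod>i<n. s $ i)"
  have q: "cmod q = 1"
    unfolding q_def prod_norm[symmetric] using s(2) by (intro prod.neutral) auto
  \<comment> \<open>The scalar \<open>c\<close> comes from counting: the set of roots has
    \<open>Suc n\<close> elements, so it is not empty.\<close>
  then have "card {z. z ^ Suc n = 1 / q} = Suc n"
    by (intro card_nth_roots) auto
  then obtain c where c: "c ^ Suc n = 1 / q"
    by (metis (mono_tags) card.empty empty_Collect_eq nat.distinct(1))
  then have "cmod (c ^ Suc n) = 1"
    using q by (simp only: norm_divide) simp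
  then have "cmod c ^ Suc n = 1" by (simp only: norm_power)
  then have c1: "cmod c = 1"
    using power_eq_imp_eq_base[of "cmod c" "Suc n" 1] by simp
  \<comment> \<open>Torus coordinate \<open>j\<close> belongs at diagonal position
    \<open>Suc j\<close>; position 0 carries only the normalizing factor \<open>c\<close>.\<close>
  define d where "d i = (case i of 0 \<Rightarrow> c | Suc j \<Rightarrow> c * s $ j)" for i
  have "(\<Prod>i<Suc n. d i) = c ^ Suc n * q"
    by (subst prod.lessThan_Suc_shift) (simp add: d_def prod.distrib q_def)
  also have "\<dots> = 1" using c q by auto
  finally have "mat_diag (Suc n) d \<in> diag_SU (Suc n)"
    using s(2) c1 by (auto simp: mat_diag_in_diag_SU d_def norm_mult split: nat.split)
  moreover have "diag_ratio n (mat_diag (Suc n) d) = s"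
    using s c1 by (auto simp: d_def intro!: eq_vecI)
  ultimately show thesis by (rule that)
qed

text \<open>Equal ratios force proportional diagonals, and comparing determinants makes the factor a
  root of unity. The equality of sets is used literally: a coset is a fiber of the ratio
  map.\<close>

lemma diag_ratio_fiber:
  assumes "A \<in> diag_SU (Suc n)"
  shows "{B \<in> diag_SU (Suc n). diag_ratio n B = diag_ratio n A} = PSU_proj (Suc n) A"
proof -
  obtain a where a: "A = mat_diag (Suc n) a" "\<And>i. i < Suc n \<Longrightarrow> cmod (a i) = 1"
    "(\<Prod>i<Suc n. a i) = 1"
    using assms by (rule diag_SU_E) blast
  have a0: "a 0 \<noteq> 0" using a(2)[of 0] by auto
  have proj: "PSU_proj (Suc n) A = {mat_diag (Suc n) (\<lambda>i. \<zeta> * a i) | \<zeta>. \<zeta> ^ Suc n = 1}"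
    unfolding PSU_proj_alt[OF diag_SU_carrier[OF assms]] unfolding a(1) smult_mat_diag ..
  show ?thesis
  proof (intro equalityI subsetI)
    fix B assume "B \<in> {B \<in> diag_SU (Suc n). diag_ratio n B = diag_ratio n A}"
    then have B: "B \<in> diag_SU (Suc n)" "diag_ratio n B = diag_ratio n A" by auto
    obtain b where b: "B = mat_diag (Suc n) b" "\<And>i. i < Suc n \<Longrightarrow> cmod (b i) = 1"
      "(\<Prod>i<Suc n. b i) = 1"
      using B(1) by (rule diag_SU_E) blast
    have b0: "b 0 \<noteq> 0" using b(2)[of 0] by auto
    \<comment> \<open>The only possible factor, as position 0 shows; equality of the ratios carries
      it to all other positions.\<close>
    define \<zeta> where "\<zeta> = b 0 / a 0"
    have eq: "b i = \<zeta> * a i" if "i < Suc n" for i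
    proof (cases i)
      case 0
      then show ?thesis using a0 by (simp add: \<zeta>_def)
    next
      case (Suc j)
      then have "diag_ratio n B $ j = diag_ratio n A $ j" "j < n" using B(2) that by auto
      then have "b (Suc j) / b 0 = a (Suc j) / a 0" by (simp add: a(1) b(1))
      then show ?thesis using a0 b0 Suc by (simp add: \<zeta>_def field_simps)
    qed
    then have "(\<Prod>i<Suc n. b i) = (\<Prod>i<Suc n. \<zeta> * a i)" by (intro prod.cong) auto
    also have "\<dots> = \<zeta> ^ Suc n * (\<Prod>i<Suc n. a i)"
      by (simp only: prod.distrib prod_constant card_lessThan)
    finally have "\<zeta> ^ Suc n = 1" using a(3) b(3) by simp
    moreover have "B = mat_diag (Suc n) (\<lambda>i. \<zeta> * a i)"
      unfolding b(1) mat_diag_eq_iff using eq by blast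
    ultimately show "B \<in> PSU_proj (Suc n) A" unfolding proj by blast
  next
    fix B assume "B \<in> PSU_proj (Suc n) A"
    then obtain \<zeta> where \<zeta>: "\<zeta> ^ Suc n = 1" and B: "B = mat_diag (Suc n) (\<lambda>i. \<zeta> * a i)"
      unfolding proj by blast
    have "cmod \<zeta> ^ Suc n = 1" using \<zeta> by (simp only: norm_one flip: norm_power)
    then have \<zeta>1: "cmod \<zeta> = 1"
      using power_eq_imp_eq_base[of "cmod \<zeta>" "Suc n" 1] by simp
    have "(\<Prod>i<Suc n. \<zeta> * a i) = 1"
      using a(3) \<zeta> by (simp only: prod.distrib prod_constant card_lessThan mult_1)
    then have "B \<in> diag_SU (Suc n)"
      unfolding B mat_diag_in_diag_SU using a(2) \<zeta>1 by (auto simp: norm_mult)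
    moreover have "diag_ratio n B = diag_ratio n A"
      using \<zeta>1 by (auto simp: B a(1) intro!: eq_vecI)
    ultimately show "B \<in> {B \<in> diag_SU (Suc n). diag_ratio n B = diag_ratio n A}" by simp
  qed
qed

section \<open>Products of cosets and their action on the chart domain\<close>

lemma PSU_proj_mult:
  assumes "A \<in> carrier_mat m m" "B \<in> carrier_mat m m"
  shows "PSU_proj m A \<otimes>\<^bsub>PSU m\<^esub> PSU_proj m B = PSU_proj m (A * B)"
proof -
  have *: "(\<zeta> \<cdot>\<^sub>m A) * (\<eta> \<cdot>\<^sub>m B) = (\<zeta> * \<eta>) \<cdot>\<^sub>m (A * B)" for \<zeta> \<eta>
    using assms
    by (simp add: mult_smult_assoc_mat[of _ m m] mult_smult_distrib[of _ m m])
      (auto intro!: eq_matI simp: mult_ac)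
  have "PSU_proj m A \<otimes>\<^bsub>PSU m\<^esub> PSU_proj m B =
      {X * Y | X Y. X \<in> PSU_proj m A \<and> Y \<in> PSU_proj m B}"
    by (auto simp: PSU_def FactGroup_def set_mult_def SU_def)
  also have "\<dots> = {(\<zeta> \<cdot>\<^sub>m A) * (\<eta> \<cdot>\<^sub>m B) | \<zeta> \<eta>. \<zeta> ^ m = 1 \<and> \<eta> ^ m = 1}"
    unfolding PSU_proj_alt[OF assms(1)] PSU_proj_alt[OF assms(2)] by blast
  also have "\<dots> = {(\<zeta> * \<eta>) \<cdot>\<^sub>m (A * B) | \<zeta> \<eta>. \<zeta> ^ m = 1 \<and> \<eta> ^ m = 1}"
    by (simp only: *)
  \<comment> \<open>Products of two \<open>m\<close>-th roots of unity are again such roots, and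
    each root arises by taking 1 as the second factor.\<close>
  also have "\<dots> = {\<zeta> \<cdot>\<^sub>m (A * B) | \<zeta>. \<zeta> ^ m = 1}"
  proof (intro equalityI subsetI)
    fix X assume "X \<in> {(\<zeta> * \<eta>) \<cdot>\<^sub>m (A * B) | \<zeta> \<eta>. \<zeta> ^ m = 1 \<and> \<eta> ^ m = 1}"
    then show "X \<in> {\<zeta> \<cdot>\<^sub>m (A * B) | \<zeta>. \<zeta> ^ m = 1}"
      by (force simp: power_mult_distrib)
  next
    fix X assume "X \<in> {\<zeta> \<cdot>\<^sub>m (A * B) | \<zeta>. \<zeta> ^ m = 1}"
    then obtain \<zeta> where "\<zeta> ^ m = 1" "X = (\<zeta> * 1) \<cdot>\<^sub>m (A * B)" by auto
    then show "X \<in> {(\<zeta> * \<eta>) \<cdot>\<^sub>m (A * B) | \<zeta> \<eta>. \<zeta> ^ m = 1 \<and> \<eta> ^ m = 1}"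
      using power_one by blast
  qed
  also have "\<dots> = PSU_proj m (A * B)"
    using assms by (simp add: PSU_proj_alt)
  finally show ?thesis .
qed

lemma U0_E:
  assumes "p \<in> U0 n"
  obtains w where "p = proj_point w" "w \<in> carrier_vec (Suc n)" "w $ 0 \<noteq> 0"
  using assms unfolding U0_def by blast

text \<open>Dividing by the new zeroth entry \<open>a 0 * w $ 0\<close> turns
  \<open>a (Suc i) * w $ Suc i\<close> into the product of a ratio of \<open>A\<close> and a chart
  coordinate of \<open>w\<close>. Unimodularity of \<open>a 0\<close> keeps that entry
  nonzero.\<close>

lemma diag_SU_mult_vec:
  assumes "A \<in> diag_SU (Suc n)" "w \<in> carrier_vec (Suc n)" "w $ 0 \<noteq> 0"
  shows "A *\<^sub>v w \<in> carrier_vec (Suc n)" "(A *\<^sub>v w) $ 0 \<noteq> 0"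
    "chart0 n (proj_point (A *\<^sub>v w)) = torus_act n (diag_ratio n A) (chart0 n (proj_point w))"
proof -
  obtain a where a: "A = mat_diag (Suc n) a" "\<And>i. i < Suc n \<Longrightarrow> cmod (a i) = 1"
    using assms(1) by (rule diag_SU_E) blast
  have a0: "a 0 \<noteq> 0" using a(2)[of 0] by auto
  show c: "A *\<^sub>v w \<in> carrier_vec (Suc n)"
    using diag_SU_carrier[OF assms(1)] assms(2) by (rule mult_mat_vec_carrier)
  show nz: "(A *\<^sub>v w) $ 0 \<noteq> 0"
    using assms a0 by (simp only: a(1) mat_diag_mult_vec zero_less_Suc) simp
  show "chart0 n (proj_point (A *\<^sub>v w)) = torus_act n (diag_ratio n A) (chart0 n (proj_point w))"
    unfolding chart0_proj_point[OF c nz] chart0_proj_point[OF assms(2,3)]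
    using a0 assms(2,3)
    by (intro eq_vecI)
      (simp_all add: a(1) mat_diag_mult_vec torus_act_def del: index_mult_mat_vec)
qed

lemma diag_SU_act:
  assumes "A \<in> diag_SU (Suc n)" "p \<in> U0 n"
  shows "PSU_act (PSU_proj (Suc n) A) p \<in> U0 n"
    "chart0 n (PSU_act (PSU_proj (Suc n) A) p) = torus_act n (diag_ratio n A) (chart0 n p)"
proof -
  obtain w where w: "p = proj_point w" "w \<in> carrier_vec (Suc n)" "w $ 0 \<noteq> 0"
    using assms(2) by (rule U0_E)
  have act: "PSU_act (PSU_proj (Suc n) A) p = proj_point (A *\<^sub>v w)"
    unfolding w(1) using diag_SU_carrier[OF assms(1)] w(2) by (rule PSU_act_proj_point)
  note Aw = diag_SU_mult_vec[OF assms(1) w(2,3)]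
  show "PSU_act (PSU_proj (Suc n) A) p \<in> U0 n"
    unfolding act U0_def using Aw(1,2) by blast
  show "chart0 n (PSU_act (PSU_proj (Suc n) A) p) = torus_act n (diag_ratio n A) (chart0 n p)"
    unfolding act unfolding w(1) by (rule Aw(3))
qed

lemma AA_carrier: "carrier (AA n) = PSU_proj (Suc n) ` diag_SU (Suc n)"
  by (simp add: AA_def)

section \<open>The torus as the group of diagonal matrices and as its projective quotient\<close>

lemma rho_diag_SU:
  assumes "t \<in> carrier (torus n)"
  shows "rho n t \<in> diag_SU (Suc n)"
proof -
  have t: "\<And>i. i < n \<Longrightarrow> cmod (t $ i) = 1" using assms by (simp add: torus_carrier)
  have "(\<Prod>i<n. t $ i) * (\<Prod>i<n. cnj (t $ i)) = 1"
    unfolding prod.distrib[symmetric]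
    using t by (intro prod.neutral) (simp flip: complex_norm_square)
  moreover have "(\<Prod>i<n. cmod (t $ i)) = 1" using t by (intro prod.neutral) auto
  ultimately show ?thesis
    using t by (auto simp: rho_def mat_diag_in_diag_SU less_Suc_eq simp flip: prod_norm)
qed

text \<open>The inverse reads off the first \<open>n\<close> diagonal entries; nothing is lost,
  because determinant 1 fixes the last one.\<close>

lemma rho_iso: "rho n \<in> iso (torus n) (Ahat n)"
proof (rule isoI)
  have "rho n (s \<otimes>\<^bsub>torus n\<^esub> t) = rho n s * rho n t" for s t
    by (auto simp: rho_def torus_mult mat_diag_eq_iff prod.distrib)
  then show "rho n \<in> hom (torus n) (Ahat n)"
    by (auto intro!: homI simp: rho_diag_SU Ahat_def) (simp add: SU_def)
  show "bij_betw (rho n) (carrier (torus n)) (carrier (Ahat n))"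
  proof (rule bij_betw_byWitness[where f' = "\<lambda>A. vec n (\<lambda>i. A $$ (i, i))"])
    show "\<forall>t\<in>carrier (torus n). vec n (\<lambda>i. rho n t $$ (i, i)) = t"
      by (auto simp: rho_def torus_carrier intro!: eq_vecI)
    show "\<forall>A\<in>carrier (Ahat n). rho n (vec n (\<lambda>i. A $$ (i, i))) = A"
    proof
      fix A assume "A \<in> carrier (Ahat n)"
      then have "A \<in> diag_SU (Suc n)" by (simp add: Ahat_def)
      then obtain d where d: "A = mat_diag (Suc n) d" "\<And>i. i < Suc n \<Longrightarrow> cmod (d i) = 1"
        "(\<Prod>i<Suc n. d i) = 1"
        by (rule diag_SU_E) blast
      \<comment> \<open>Multiplying by the determinant lets each conjugate cancel against its own
        entry, which leaves \<open>d n\<close>.\<close>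
      have "(\<Prod>i<n. cnj (d i)) = (\<Prod>i<n. cnj (d i)) * ((\<Prod>i<n. d i) * d n)"
        using d(3) by simp
      also have "\<dots> = (\<Prod>i<n. cnj (d i) * d i) * d n"
        by (simp add: prod.distrib)
      also have "(\<Prod>i<n. cnj (d i) * d i) = 1"
        using d(2) by (intro prod.neutral) (simp add: mult.commute flip: complex_norm_square)
      finally show "rho n (vec n (\<lambda>i. A $$ (i, i))) = A"
        by (auto simp: rho_def d(1) mat_diag_eq_iff less_Suc_eq)
    qed
    show "rho n ` carrier (torus n) \<subseteq> carrier (Ahat n)"
      by (auto simp: Ahat_def rho_diag_SU)
    show "(\<lambda>A. vec n (\<lambda>i. A $$ (i, i))) ` carrier (Ahat n) \<subseteq> carrier (torus n)"
      by (auto simp: Ahat_def torus_carrier elim!: diag_SU_E)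
  qed
qed

text \<open>The inverse of the isomorphism induced by the ratios. Since an element of
  \<open>AA n\<close> is itself a set of matrices, the fiber over \<open>s\<close> can serve as the
  value, with no choice of a representative.\<close>

definition torus_to_AA :: "nat \<Rightarrow> complex vec \<Rightarrow> complex mat set" where
  "torus_to_AA n s = {A \<in> diag_SU (Suc n). diag_ratio n A = s}"

lemma torus_to_AA_diag_ratio:
  "A \<in> diag_SU (Suc n) \<Longrightarrow> torus_to_AA n (diag_ratio n A) = PSU_proj (Suc n) A"
  unfolding torus_to_AA_def by (rule diag_ratio_fiber)

text \<open>Multiplicativity passes through representatives by \<open>diag_ratio_mult\<close>.
  Injectivity holds because fibers over torus points are nonempty and a matrix has only one ratio
  vector; surjectivity because each class is the fiber over its own ratios.\<close>

lemma torus_to_AA_iso: "torus_to_AA n \<in> iso (torus n) (AA n)"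
proof -
  have AA: "torus_to_AA n s \<in> carrier (AA n)" if "s \<in> carrier (torus n)" for s
    using that by (rule diag_ratio_surj) (auto simp: AA_carrier torus_to_AA_diag_ratio)
  have "torus_to_AA n (s \<otimes>\<^bsub>torus n\<^esub> t) = torus_to_AA n s \<otimes>\<^bsub>AA n\<^esub> torus_to_AA n t"
    if s: "s \<in> carrier (torus n)" and t: "t \<in> carrier (torus n)" for s t
  proof -
    obtain A where A: "A \<in> diag_SU (Suc n)" "diag_ratio n A = s" using s by (rule diag_ratio_surj)
    obtain B where B: "B \<in> diag_SU (Suc n)" "diag_ratio n B = t" using t by (rule diag_ratio_surj)
    have "torus_to_AA n (s \<otimes>\<^bsub>torus n\<^esub> t) = PSU_proj (Suc n) (A * B)"
      using A B by (metis diag_ratio_mult diag_SU_mult torus_to_AA_diag_ratio)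
    also have "\<dots> = PSU_proj (Suc n) A \<otimes>\<^bsub>PSU (Suc n)\<^esub> PSU_proj (Suc n) B"
      using A(1) B(1) by (simp add: PSU_proj_mult diag_SU_carrier)
    also have "\<dots> = torus_to_AA n s \<otimes>\<^bsub>AA n\<^esub> torus_to_AA n t"
      using A B by (auto simp: AA_def simp flip: torus_to_AA_diag_ratio)
    finally show ?thesis .
  qed
  then have "torus_to_AA n \<in> hom (torus n) (AA n)" using AA by (intro homI)
  moreover have "inj_on (torus_to_AA n) (carrier (torus n))"
  proof (rule inj_onI)
    fix s t assume s: "s \<in> carrier (torus n)" and eq: "torus_to_AA n s = torus_to_AA n t"
    obtain A where "A \<in> diag_SU (Suc n)" "diag_ratio n A = s" using s by (rule diag_ratio_surj)
    then have "A \<in> torus_to_AA n t" unfolding eq[symmetric] by (simp add: torus_to_AA_def)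
    then show "s = t" using \<open>diag_ratio n A = s\<close> by (simp add: torus_to_AA_def)
  qed
  moreover have "carrier (AA n) \<subseteq> torus_to_AA n ` carrier (torus n)"
    unfolding AA_carrier
    by (intro image_subsetI, subst torus_to_AA_diag_ratio[symmetric])
      (simp_all add: diag_ratio_torus)
  ultimately show ?thesis using AA by (auto simp: iso_iff)
qed

lemma torus_to_AA_act:
  assumes "t \<in> carrier (torus n)" "p \<in> U0 n"
  shows "chart0 n (PSU_act (torus_to_AA n t) p) = torus_act n t (chart0 n p)"
proof -
  obtain A where "A \<in> diag_SU (Suc n)" "diag_ratio n A = t"
    using assms(1) by (rule diag_ratio_surj)
  then show ?thesis using diag_SU_act(2) assms(2) torus_to_AA_diag_ratio by metis
qed

section \<open>Separately radial functions as torus invariants\<close>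

lemma torus_act_transitive:
  assumes "z \<in> carrier_vec n" "z' \<in> carrier_vec n" "\<And>i. i < n \<Longrightarrow> cmod (z $ i) = cmod (z' $ i)"
  obtains t where "t \<in> carrier (torus n)" "torus_act n t z = z'"
proof (rule that)
  \<comment> \<open>Where \<open>z\<close> vanishes so does \<open>z'\<close>, and any unimodular
    value would do; 1 replaces the quotient, whose value there would be 0 and so leave the
    torus.\<close>
  let ?t = "vec n (\<lambda>i. if z $ i = 0 then 1 else z' $ i / z $ i)"
  have zero: "z $ i = 0 \<longleftrightarrow> z' $ i = 0" if "i < n" for i
    using assms(3)[OF that] by (metis norm_eq_zero)
  show "?t \<in> carrier (torus n)"
    using assms(3) zero by (simp add: torus_carrier norm_divide)
  show "torus_act n ?t z = z'"
    using assms(2) zero by (intro eq_vecI) (auto simp: torus_act_def)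
qed

lemma separately_radial_iff_torus_invariant:
  "separately_radial n a \<longleftrightarrow>
    (\<forall>t\<in>carrier (torus n). \<forall>z\<in>carrier_vec n. a (torus_act n t z) = a z)"
proof
  assume radial: "separately_radial n a"
  show "\<forall>t\<in>carrier (torus n). \<forall>z\<in>carrier_vec n. a (torus_act n t z) = a z"
  proof (intro ballI)
    fix t z :: "complex vec" assume "t \<in> carrier (torus n)" "z \<in> carrier_vec n"
    moreover from this have "\<forall>i<n. cmod (torus_act n t z $ i) = cmod (z $ i)"
      by (simp add: torus_act_def torus_carrier norm_mult)
    moreover have "torus_act n t z \<in> carrier_vec n" by (simp add: torus_act_def)
    ultimately show "a (torus_act n t z) = a z"
      using radial unfolding separately_radial_def by blast
  qed
next
  assume inv: "\<forall>t\<in>carrier (torus n). \<forall>z\<in>carrier_vec n. a (torus_act n t z) = a z"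
  show "separately_radial n a"
    unfolding separately_radial_def
  proof (intro ballI impI)
    fix z z' :: "complex vec" assume z: "z \<in> carrier_vec n" "z' \<in> carrier_vec n"
      and "\<forall>i<n. cmod (z $ i) = cmod (z' $ i)"
    then obtain t where "t \<in> carrier (torus n)" "torus_act n t z = z'"
      using torus_act_transitive by blast
    then show "a z = a z'" using inv z by metis
  qed
qed

text \<open>Surjectivity of \<open>torus_to_AA n\<close> and of the chart turns quantification over
  classes and points into quantification over torus elements and vectors; equivariance does the
  rest.\<close>

lemma AA_invariant_iff_torus_invariant:
  "AA_invariant n (a \<circ> chart0 n) \<longleftrightarrow>
    (\<forall>t\<in>carrier (torus n). \<forall>z\<in>carrier_vec n. a (torus_act n t z) = a z)"
proof -
  have "carrier (AA n) = torus_to_AA n ` carrier (torus n)"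
    using torus_to_AA_iso by (auto simp: iso_iff)
  moreover have "carrier_vec n = chart0 n ` U0 n"
    using chart0_bij by (auto simp: bij_betw_def)
  ultimately show ?thesis by (simp add: AA_invariant_def torus_to_AA_act)
qed

text \<open>By \<open>rho_not_equivariant\<close>, for positive \<open>n\<close> the matrix
  \<open>rho n t\<close> does not act in the chart as \<open>t\<close>, so its equivariance is
  stated with \<open>rho_ratio n t\<close>. The action of \<open>t\<close> itself is realized by the
  isomorphism \<theta>, which is tied to \<open>rho\<close> by sending \<open>rho_ratio n t\<close>
  to the class of \<open>rho n t\<close>.\<close>

theorem lemma6p1:
  fixes n :: nat
  shows "(\<forall>g\<in>carrier (AA n). \<forall>p\<in>U0 n. PSU_act g p \<in> U0 n) \<and>
    rho n \<in> iso (torus n) (Ahat n) \<and>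
    (\<forall>t\<in>carrier (torus n). \<forall>w\<in>carrier_vec (Suc n). w $ 0 \<noteq> 0 \<longrightarrow>
       torus_act n (rho_ratio n t) (chart0 n (proj_point w)) = chart0 n (proj_point (rho n t *\<^sub>v w))) \<and>
    (\<exists>\<theta>\<in>iso (torus n) (AA n).
       (\<forall>t\<in>carrier (torus n). \<theta> (rho_ratio n t) = PSU_proj (Suc n) (rho n t)) \<and>
       (\<forall>t\<in>carrier (torus n). \<forall>p\<in>U0 n. torus_act n t (chart0 n p) = chart0 n (PSU_act (\<theta> t) p))) \<and>
    (\<forall>a :: complex vec \<Rightarrow> complex.
       separately_radial n a \<longleftrightarrow> AA_invariant n (a \<circ> chart0 n))"
proof (intro conjI allI ballI impI)
  show "PSU_act g p \<in> U0 n" if "g \<in> carrier (AA n)" "p \<in> U0 n" for g p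
    using that diag_SU_act(1) by (auto simp: AA_carrier)
  show "rho n \<in> iso (torus n) (Ahat n)" by (rule rho_iso)
  show "torus_act n (rho_ratio n t) (chart0 n (proj_point w)) = chart0 n (proj_point (rho n t *\<^sub>v w))"
    if "t \<in> carrier (torus n)" "w \<in> carrier_vec (Suc n)" "w $ 0 \<noteq> 0" for t w
    unfolding rho_ratio_eq using diag_SU_mult_vec(3)[OF rho_diag_SU] that by simp
  show "\<exists>\<theta>\<in>iso (torus n) (AA n).
      (\<forall>t\<in>carrier (torus n). \<theta> (rho_ratio n t) = PSU_proj (Suc n) (rho n t)) \<and>
      (\<forall>t\<in>carrier (torus n). \<forall>p\<in>U0 n. torus_act n t (chart0 n p) = chart0 n (PSU_act (\<theta> t) p))"
    using torus_to_AA_iso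
    \<comment> \<open>The rotation puts the membership premise first, so that the chained fact fixes
      \<open>torus_to_AA n\<close> as the witness.\<close>
    by (rule bexI[rotated])
      (simp add: rho_ratio_eq torus_to_AA_diag_ratio rho_diag_SU torus_to_AA_act)
  show "separately_radial n a \<longleftrightarrow> AA_invariant n (a \<circ> chart0 n)" for a :: "complex vec \<Rightarrow> complex"
    unfolding separately_radial_iff_torus_invariant AA_invariant_iff_torus_invariant ..
qed

end
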